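(* Let $s$ and $t$ be terms which cannot be unified. Then $s$ and $t$ are separated in some finite algebra.
   Context: Terms are built from variables in an algebraic language with (possibly infinitely many) operation symbols of finite arity, constants allowed as $0$-ary symbols. Terms $s$ and $t$ can be unified if there is a substitution of terms for the variables (applied simultaneously to both) that turns $s$ and $t$ into the same term. An algebra $\mathbf{A}$ of this language separates $s(x_1,\dots,x_k)$ and $t(x_1,\dots,x_k)$ if $s(a_1,\dots,a_k)\neq t(a_1,\dots,a_k)$ for all $a_1,\dots,a_k\in A$. *)

theory Defs
  imports Main
begin

text \<open>A language is a type \<open>'f\<close> of operation symbols (of any size) together with an arity function
  \<open>ar :: 'f \<Rightarrow> nat\<close>; constants are the symbols of arity \<open>0\<close>. The datatype does not enforce arities,
  so the terms of the language are those satisfying \<open>wf_trm ar\<close>.\<close>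

datatype ('f, vars_trm: 'v) trm = Var 'v | Fn 'f "('f, 'v) trm list"

fun wf_trm :: "('f \<Rightarrow> nat) \<Rightarrow> ('f, 'v) trm \<Rightarrow> bool" where
  "wf_trm ar (Var x) \<longleftrightarrow> True"
| "wf_trm ar (Fn f ts) \<longleftrightarrow> length ts = ar f \<and> (\<forall>t \<in> set ts. wf_trm ar t)"

primrec subst :: "('v \<Rightarrow> ('f, 'v) trm) \<Rightarrow> ('f, 'v) trm \<Rightarrow> ('f, 'v) trm" where
  "subst \<sigma> (Var x) = \<sigma> x"
| "subst \<sigma> (Fn f ts) = Fn f (map (subst \<sigma>) ts)"

definition unifiable :: "('f \<Rightarrow> nat) \<Rightarrow> ('f, 'v) trm \<Rightarrow> ('f, 'v) trm \<Rightarrow> bool" where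
  "unifiable ar s t \<longleftrightarrow> (\<exists>\<sigma>. (\<forall>x. wf_trm ar (\<sigma> x)) \<and> subst \<sigma> s = subst \<sigma> t)"

text \<open>Universes are nonempty, as usual in universal algebra. The empty set would trivially separate
  any two terms that contain a variable. \<open>F f\<close> is only constrained on argument lists of length
  \<open>ar f\<close> over \<open>A\<close>.\<close>

definition algebra :: "('f \<Rightarrow> nat) \<Rightarrow> 'a set \<Rightarrow> ('f \<Rightarrow> 'a list \<Rightarrow> 'a) \<Rightarrow> bool" where
  "algebra ar A F \<longleftrightarrow>
     A \<noteq> {} \<and> (\<forall>f xs. length xs = ar f \<longrightarrow> set xs \<subseteq> A \<longrightarrow> F f xs \<in> A)"

primrec eval_trm :: "('f \<Rightarrow> 'a list \<Rightarrow> 'a) \<Rightarrow> ('v \<Rightarrow> 'a) \<Rightarrow> ('f, 'v) trm \<Rightarrow> 'a" where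
  "eval_trm F a (Var x) = a x"
| "eval_trm F a (Fn f ts) = F f (map (eval_trm F a) ts)"

definition separates ::
  "'a set \<Rightarrow> ('f \<Rightarrow> 'a list \<Rightarrow> 'a) \<Rightarrow> ('f, 'v) trm \<Rightarrow> ('f, 'v) trm \<Rightarrow> bool" where
  "separates A F s t \<longleftrightarrow>
     (\<forall>a. (\<forall>x \<in> vars_trm s \<union> vars_trm t. a x \<in> A) \<longrightarrow> eval_trm F a s \<noteq> eval_trm F a t)"

end

(* Run syntactic unification on a finite system of equations: each step preserves
   non-unifiability, and a finite algebra without a solution of the new system yields one
   without a solution of the old system.

   Decomposing f(ss) = f(ts): enlarge the algebra so that the value of a term headed by f also
   records the values of its immediate subterms. Eliminating x = t with x not in t: the same
   algebra works, since x and t take equal values in every solution. Two failures remain.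
   A clash of head symbols f, g is separated by the two-element algebra whose operations are all
   constant and which singles out f. If x occurs properly in t, along the path p of length m > 0,
   let the algebra count, modulo m + 1, how far one can descend in a term following p cyclically
   (starting at any point of p). The counts of t and x then differ by m. *)

theory Submission
  imports Defs "HOL-Library.Countable"
begin

section \<open>Systems of equations\<close>

type_synonym ('f, 'v) eqns = "(('f, 'v) trm \<times> ('f, 'v) trm) list"

definition wf_eqns :: "('f \<Rightarrow> nat) \<Rightarrow> ('f, 'v) eqns \<Rightarrow> bool" where
  "wf_eqns ar E \<longleftrightarrow> (\<forall>l r. (l, r) \<in> set E \<longrightarrow> wf_trm ar l \<and> wf_trm ar r)"

definition unifiable_eqns :: "('f \<Rightarrow> nat) \<Rightarrow> ('f, 'v) eqns \<Rightarrow> bool" where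
  "unifiable_eqns ar E \<longleftrightarrow>
     (\<exists>\<sigma>. (\<forall>x. wf_trm ar (\<sigma> x)) \<and>
       (\<forall>l r. (l, r) \<in> set E \<longrightarrow> subst \<sigma> l = subst \<sigma> r))"

definition solves :: "('f \<Rightarrow> 'a list \<Rightarrow> 'a) \<Rightarrow> ('v \<Rightarrow> 'a) \<Rightarrow> ('f, 'v) eqns \<Rightarrow> bool" where
  "solves F a E \<longleftrightarrow> (\<forall>l r. (l, r) \<in> set E \<longrightarrow> eval_trm F a l = eval_trm F a r)"

text \<open>Assignments map every variable into \<open>A\<close>, not only those of
  \<open>E\<close>; nonemptiness of \<open>A\<close> reconciles this with \<open>separates\<close>
  at the end.\<close>

definition refutes ::
  "('f \<Rightarrow> nat) \<Rightarrow> 'a set \<Rightarrow> ('f \<Rightarrow> 'a list \<Rightarrow> 'a) \<Rightarrow> ('f, 'v) eqns \<Rightarrow> bool" where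
  "refutes ar A F E \<longleftrightarrow>
     finite A \<and> algebra ar A F \<and> (\<forall>a. range a \<subseteq> A \<longrightarrow> \<not> solves F a E)"

text \<open>The universe is a set of naturals because a definition cannot quantify over carrier
  types.\<close>

definition refutable :: "('f \<Rightarrow> nat) \<Rightarrow> ('f, 'v) eqns \<Rightarrow> bool" where
  "refutable ar E \<longleftrightarrow> (\<exists>(A :: nat set) F. refutes ar A F E)"

definition vars_eqns :: "('f, 'v) eqns \<Rightarrow> 'v set" where
  "vars_eqns E = (\<Union>(l, r) \<in> set E. vars_trm l \<union> vars_trm r)"

abbreviation subst_eqns :: "('v \<Rightarrow> ('f, 'v) trm) \<Rightarrow> ('f, 'v) eqns \<Rightarrow> ('f, 'v) eqns" where
  "subst_eqns \<sigma> \<equiv> map (map_prod (subst \<sigma>) (subst \<sigma>))"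

section \<open>Variables, substitution and evaluation\<close>

lemma finite_vars_trm: "finite (vars_trm t)"
  by (induction t) auto

lemma finite_vars_eqns: "finite (vars_eqns E)"
  by (auto simp: vars_eqns_def finite_vars_trm)

lemma subst_cong: "(\<And>x. x \<in> vars_trm t \<Longrightarrow> \<sigma> x = \<tau> x) \<Longrightarrow> subst \<sigma> t = subst \<tau> t"
  by (induction t) auto

lemma subst_Var: "subst Var t = t"
  by (induction t) (auto intro: map_idI)

lemma subst_subst: "subst \<tau> (subst \<sigma> t) = subst (\<lambda>x. subst \<tau> (\<sigma> x)) t"
  by (induction t) auto

lemma subst_upd_notin: "x \<notin> vars_trm t \<Longrightarrow> subst (Var(x := u)) t = t"
  by (metis fun_upd_other subst_Var subst_cong)

lemma wf_trm_subst: "wf_trm ar t \<Longrightarrow> (\<And>x. wf_trm ar (\<sigma> x)) \<Longrightarrow> wf_trm ar (subst \<sigma> t)"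
  by (induction t) auto

lemma vars_trm_subst: "vars_trm (subst \<sigma> t) = (\<Union>x \<in> vars_trm t. vars_trm (\<sigma> x))"
  by (induction t) auto

lemma eval_trm_subst: "eval_trm F a (subst \<sigma> t) = eval_trm F (\<lambda>x. eval_trm F a (\<sigma> x)) t"
  by (induction t) (auto intro!: arg_cong[where f = "F _"])

lemma eval_trm_cong: "(\<And>x. x \<in> vars_trm t \<Longrightarrow> a x = b x) \<Longrightarrow> eval_trm F a t = eval_trm F b t"
proof (induction t)
  case (Fn f ts)
  have "map (eval_trm F a) ts = map (eval_trm F b) ts"
    using Fn by (intro map_cong) auto
  thus ?case by (simp only: eval_trm.simps)
qed simp

text \<open>Applied with \<open>from_nat\<close> and \<open>fst\<close> as \<open>h\<close>: a
  solution in a coded or enlarged algebra maps to one in the original algebra.\<close>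

lemma eval_trm_hom:
  assumes "\<And>f xs. h (F f xs) = G f (map h xs)"
  shows "h (eval_trm F a t) = eval_trm G (\<lambda>x. h (a x)) t"
  by (induction t) (auto simp: assms intro!: arg_cong[where f = "G _"])

section \<open>Finite algebras without solutions\<close>

text \<open>Copy the algebra along \<open>to_nat\<close>; \<open>from_nat\<close> is a homomorphism
  back, so it would carry over any solution in the copy. Later constructions may thus use pairs and
  lists as elements.\<close>

lemma refutable_countable:
  fixes A :: "'a :: countable set"
  assumes "refutes ar A F E"
  shows "refutable ar E"
proof -
  define G where "G = (\<lambda>f xs. to_nat (F f (map from_nat xs)))"
  have eval: "from_nat (eval_trm G a t) = eval_trm F (\<lambda>x. from_nat (a x)) t"
    for a :: "'c \<Rightarrow> nat" and t :: "('b, 'c) trm"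
    by (rule eval_trm_hom) (simp add: G_def)
  have "\<not> solves G a E" if "range a \<subseteq> to_nat ` A" for a
  proof
    assume "solves G a E"
    hence "solves F (\<lambda>x. from_nat (a x)) E"
      by (auto simp: solves_def simp flip: eval)
    moreover have "range (\<lambda>x. from_nat (a x)) \<subseteq> A" 
    proof safe
      fix x
      have "a x \<in> to_nat ` A" using that by blast
      thus "from_nat (a x) \<in> A" by auto
    qed
    ultimately show False using assms by (auto simp: refutes_def)
  qed
  moreover have "algebra ar (to_nat ` A) G"
    unfolding algebra_def
  proof (intro conjI allI impI)
    show "to_nat ` A \<noteq> {}" using assms by (auto simp: refutes_def algebra_def)
    fix f and xs :: "nat list"
    assume "length xs = ar f" "set xs \<subseteq> to_nat ` A"
    hence "length (map from_nat xs :: 'a list) = ar f" "set (map from_nat xs) \<subseteq> A" by auto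
    thus "G f xs \<in> to_nat ` A"
      using assms unfolding G_def refutes_def algebra_def by blast
  qed
  ultimately have "refutes ar (to_nat ` A) G E" using assms by (simp add: refutes_def)
  thus ?thesis unfolding refutable_def by blast
qed

text \<open>Covers the steps that keep the algebra: elimination, swapping and deletion.\<close>

lemma refutable_mono:
  assumes "refutable ar E"
    and "\<And>(F :: 'f \<Rightarrow> nat list \<Rightarrow> nat) a. solves F a E' \<Longrightarrow> solves F a E"
  shows "refutable ar E'"
  using assms unfolding refutable_def refutes_def by blast

lemma refutable_clash:
  assumes "f \<noteq> g"
  shows "refutable ar ((Fn f ss, Fn g ts) # E)"
proof -
  have "refutes ar {0, 1 :: nat} (\<lambda>h _. if h = f then 1 else 0) ((Fn f ss, Fn g ts) # E)"
    using assms by (auto simp: refutes_def algebra_def solves_def)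
  thus ?thesis unfolding refutable_def by blast
qed

lemma refutable_decompose:
  assumes "refutable ar (zip ss ts @ E)"
  shows "refutable ar ((Fn f ss, Fn f ts) # E)"
proof -
  obtain A :: "nat set" and F where ref: "refutes ar A F (zip ss ts @ E)"
    using assms unfolding refutable_def by blast
  \<comment> \<open>An element pairs an old value with a record of argument values. Records hold old
    values only, so \<open>B\<close> is finite. The bound \<open>\<le>\<close> admits both full
    argument lists of \<open>f\<close> and the empty record left by other symbols.\<close>
  define B where "B = A \<times> {xs. set xs \<subseteq> A \<and> length xs \<le> ar f}"
  define G :: "'a \<Rightarrow> (nat \<times> nat list) list \<Rightarrow> nat \<times> nat list" where
    "G = (\<lambda>g xs. (F g (map fst xs), if g = f then map fst xs else []))"
  have eval: "fst (eval_trm G a t) = eval_trm F (\<lambda>x. fst (a x)) t"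
    for a :: "'b \<Rightarrow> nat \<times> nat list" and t
    by (rule eval_trm_hom) (simp add: G_def)
  have "finite B"
    using ref by (auto simp: B_def refutes_def intro: finite_lists_length_le)
  moreover have "algebra ar B G"
    unfolding algebra_def
  proof (intro conjI allI impI)
    show "B \<noteq> {}"
      using ref by (auto simp: B_def refutes_def algebra_def intro: exI[of _ "[]"])
    fix g and xs :: "(nat \<times> nat list) list"
    assume "length xs = ar g" and xs: "set xs \<subseteq> B"
    moreover have "set (map fst xs) \<subseteq> A" using xs by (auto simp: B_def)
    ultimately have "length (map fst xs) = ar g" "set (map fst xs) \<subseteq> A" "F g (map fst xs) \<in> A"
      using ref unfolding refutes_def algebra_def by (metis length_map)+
    thus "G g xs \<in> B" by (auto simp: G_def B_def)
  qed
  moreover have "\<not> solves G a ((Fn f ss, Fn f ts) # E)" if a: "range a \<subseteq> B" for a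
  proof
    assume sol: "solves G a ((Fn f ss, Fn f ts) # E)"
    let ?b = "\<lambda>x. fst (a x)"
    have "eval_trm G a (Fn f ss) = eval_trm G a (Fn f ts)" using sol by (simp add: solves_def)
    \<comment> \<open>Equal records force the arguments to have pairwise equal values in the old
      algebra.\<close>
    hence "snd (G f (map (eval_trm G a) ss)) = snd (G f (map (eval_trm G a) ts))" by simp
    moreover have "snd (G f xs) = map fst xs" for xs by (simp add: G_def)
    ultimately have "map (eval_trm F ?b) ss = map (eval_trm F ?b) ts"
      by (simp add: eval o_def)
    hence "eval_trm F ?b l = eval_trm F ?b r" if "(l, r) \<in> set (zip ss ts)" for l r
      using that by (metis (no_types, lifting) in_set_zip fst_conv nth_map snd_conv)
    moreover have "eval_trm F ?b l = eval_trm F ?b r" if "(l, r) \<in> set E" for l r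
      using sol that by (auto simp: solves_def simp flip: eval)
    ultimately have "solves F ?b (zip ss ts @ E)" unfolding solves_def by auto
    moreover have "range ?b \<subseteq> A" using a by (simp add: B_def image_subset_iff mem_Times_iff)
    ultimately show False using ref unfolding refutes_def by blast
  qed
  ultimately show ?thesis by (intro refutable_countable[of ar B G]) (simp add: refutes_def)
qed

lemma refutable_eliminate:
  assumes "refutable ar (subst_eqns (Var(x := t)) E)"
  shows "refutable ar ((Var x, t) # E)"
  using assms
proof (rule refutable_mono)
  fix F :: "'a \<Rightarrow> nat list \<Rightarrow> nat" and a
  assume sol: "solves F a ((Var x, t) # E)"
  \<comment> \<open>At \<open>x\<close> this is the equation \<open>x = t\<close> itself, so the
    substitution changes no value.\<close>
  hence "(\<lambda>y. eval_trm F a ((Var(x := t)) y)) = a" by (auto simp: solves_def)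
  thus "solves F a (subst_eqns (Var(x := t)) E)"
    using sol by (auto simp: solves_def eval_trm_subst simp del: fun_upd_apply)
qed

lemma refutable_swap: "refutable ar ((t, u) # E) \<Longrightarrow> refutable ar ((u, t) # E)"
  by (erule refutable_mono) (auto simp: solves_def)

section \<open>The occurs check\<close>

text \<open>A path lists symbols with the index of the argument to enter; keeping the symbol lets an
  operation test whether the descent passes through it.\<close>

fun leads_to :: "('f, 'v) trm \<Rightarrow> ('f \<times> nat) list \<Rightarrow> 'v \<Rightarrow> bool" where
  "leads_to t [] x \<longleftrightarrow> t = Var x"
| "leads_to (Var y) (q # p) x \<longleftrightarrow> False"
| "leads_to (Fn f ts) (q # p) x \<longleftrightarrow> fst q = f \<and> snd q < length ts \<and> leads_to (ts ! snd q) p x"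

lemma ex_path:
  fixes t :: "('f, 'v) trm"
  assumes "x \<in> vars_trm t"
  shows "\<exists>p. leads_to t p x"
  using assms
proof (induction t)
  case (Var y)
  hence "leads_to (Var y :: ('f, 'v) trm) [] x" by simp
  thus ?case by blast
next
  case (Fn f ts)
  then obtain i p where "i < length ts" "leads_to (ts ! i) p x"
    by (auto simp: in_set_conv_nth) (metis nth_mem)
  hence "leads_to (Fn f ts) ((f, i) # p) x" by simp
  thus ?case by blast
qed

lemma refutable_occurs:
  fixes t :: "('f, 'v) trm"
  assumes "x \<in> vars_trm t" and "t \<noteq> Var x"
  shows "refutable ar ((Var x, t) # E)"
proof -
  obtain p where p: "leads_to t p x" using ex_path[OF assms(1)] by blast
  define m where "m = length p"
  have m: "m > 0" using p assms(2) by (cases p) (auto simp: m_def)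
  \<comment> \<open>Entry \<open>j\<close> of a vector is the count, modulo \<open>m + 1\<close>,
    for descents starting at position \<open>j\<close> of \<open>p\<close>. In \<open>F\<close>, the
    index \<open>Suc j mod m\<close> closes the path into a cycle.\<close>
  define A where "A = {v :: nat list. set v \<subseteq> {..m} \<and> length v = m}"
  define F :: "'f \<Rightarrow> nat list list \<Rightarrow> nat list" where
    "F = (\<lambda>g xs. map (\<lambda>j. if g = fst (p ! j)
            then Suc (xs ! snd (p ! j) ! (Suc j mod m)) mod Suc m else 0) [0..<m])"
  have F_in: "F g xs \<in> A" for g xs
    by (auto simp: F_def A_def)
  \<comment> \<open>The subterm reached after \<open>j\<close> steps lies \<open>m - j\<close> steps
    above \<open>x\<close>, where the count continues from position 0; the index
    \<open>j mod m\<close> includes the end \<open>j = m\<close>.\<close>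
  have count: "eval_trm F a u ! (j mod m) mod Suc m = (a x ! 0 + (m - j)) mod Suc m"
    if "leads_to u (drop j p) x" "j \<le> m" for a u j
    using that
  proof (induction u arbitrary: j)
    case (Var y)
    hence "j = m" "y = x" by (cases "drop j p"; auto simp: m_def)+
    thus ?case by simp
  next
    case (Fn g us)
    have j: "j < m" using Fn.prems by (cases "j = m") (auto simp: m_def)
    hence dr: "drop j p = p ! j # drop (Suc j) p" by (simp add: m_def Cons_nth_drop_Suc)
    let ?i = "snd (p ! j)"
    have st: "g = fst (p ! j)" "?i < length us" "leads_to (us ! ?i) (drop (Suc j) p) x"
      using Fn.prems(1) unfolding dr by auto
    have "eval_trm F a (us ! ?i) ! (Suc j mod m) mod Suc m = (a x ! 0 + (m - Suc j)) mod Suc m"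
      using Fn.IH[of "us ! ?i" "Suc j"] st j by simp
    hence "Suc (eval_trm F a (us ! ?i) ! (Suc j mod m)) mod Suc m
        = Suc (a x ! 0 + (m - Suc j)) mod Suc m"
      by (metis mod_Suc_eq)
    moreover have "Suc (a x ! 0 + (m - Suc j)) = a x ! 0 + (m - j)" using j by simp
    ultimately show ?case using j st by (simp add: F_def)
  qed
  have "\<not> solves F a ((Var x, t) # E)" if "range a \<subseteq> A" for a
  proof
    assume "solves F a ((Var x, t) # E)"
    hence "eval_trm F a t = a x" by (simp add: solves_def)
    with count[of t 0 a] p have eq: "a x ! 0 mod Suc m = (a x ! 0 + m) mod Suc m" by simp
    \<comment> \<open>The bound makes the entry its own residue, and adding \<open>m\<close> changes
      it because \<open>0 < m < m + 1\<close>.\<close>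
    have "a x \<in> A" using that by blast
    hence "a x ! 0 \<le> m" using m by (auto simp: A_def subset_iff)
    thus False using eq m by (cases "a x ! 0") (auto simp: mod_if)
  qed
  moreover have "finite A"
    unfolding A_def by (rule finite_lists_length_eq) simp
  moreover have "algebra ar A F"
    using F_in unfolding algebra_def by blast
  ultimately show ?thesis by (intro refutable_countable[of ar A F]) (simp add: refutes_def)
qed

section \<open>Unification\<close>

text \<open>Replace \<open>x\<close> by \<open>t\<close>, then apply the unifier of the reduced
  system. As \<open>x\<close> is not in \<open>t\<close>, the replacement fixes \<open>t\<close>, so
  \<open>x\<close> and \<open>t\<close> get the same image.\<close>

lemma unifiable_eliminate:
  assumes "unifiable_eqns ar (subst_eqns (Var(x := t)) E)" and "x \<notin> vars_trm t" and "wf_trm ar t"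
  shows "unifiable_eqns ar ((Var x, t) # E)"
proof -
  obtain \<tau> where \<tau>: "\<And>y. wf_trm ar (\<tau> y)"
    "\<And>l r. (l, r) \<in> set (subst_eqns (Var(x := t)) E) \<Longrightarrow> subst \<tau> l = subst \<tau> r"
    using assms(1) unfolding unifiable_eqns_def by blast
  let ?\<sigma> = "\<lambda>y. subst \<tau> ((Var(x := t)) y)"
  have "subst ?\<sigma> t = subst \<tau> t"
    using subst_subst[of \<tau> "Var(x := t)" t] by (simp only: subst_upd_notin[OF assms(2)])
  hence "subst ?\<sigma> (Var x) = subst ?\<sigma> t" by simp
  moreover have "subst ?\<sigma> l = subst ?\<sigma> r" if "(l, r) \<in> set E" for l r
  proof -
    have "(subst (Var(x := t)) l, subst (Var(x := t)) r) \<in> set (subst_eqns (Var(x := t)) E)"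
      using that by force
    thus ?thesis by (metis \<tau>(2) subst_subst)
  qed
  moreover have "wf_trm ar (?\<sigma> y)" for y
    using \<tau>(1) assms(3) by (simp add: wf_trm_subst)
  ultimately show ?thesis unfolding unifiable_eqns_def by (intro exI[of _ ?\<sigma>]) auto
qed

lemma refutable_if_not_unifiable_eqns:
  assumes "wf_eqns ar E" and "\<not> unifiable_eqns ar E"
  shows "refutable ar E"
  using assms
\<comment> \<open>Lexicographic measure: number of variables, then total size of left-hand sides.
  Elimination lowers the first; decomposition and deletion lower the second without raising the
  first. The \<open>Suc\<close> makes every equation count.\<close>
proof (induction E rule: wf_induct_rule
    [OF wf_measures[of "[\<lambda>E. card (vars_eqns E), \<lambda>E. \<Sum>(l, r) \<leftarrow> E. Suc (size l)]"]])
  case (1 E)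
  have IH: "refutable ar E'"
    if "vars_eqns E' \<subset> vars_eqns E \<or> vars_eqns E' \<subseteq> vars_eqns E \<and>
        (\<Sum>(l, r) \<leftarrow> E'. Suc (size l)) < (\<Sum>(l, r) \<leftarrow> E. Suc (size l))"
      and "wf_eqns ar E'" "\<not> unifiable_eqns ar E'" for E'
  proof (rule "1.IH"[OF _ that(2,3)])
    have "vars_eqns E' \<subset> vars_eqns E \<Longrightarrow> card (vars_eqns E') < card (vars_eqns E)"
      and "vars_eqns E' \<subseteq> vars_eqns E \<Longrightarrow> card (vars_eqns E') \<le> card (vars_eqns E)"
      by (simp_all add: finite_vars_eqns psubset_card_mono card_mono)
    with that(1) show "(E', E) \<in> measures
        [\<lambda>E. card (vars_eqns E), \<lambda>E. \<Sum>(l, r) \<leftarrow> E. Suc (size l)]"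
      unfolding measures_less measures_lesseq in_measures le_less by blast
  qed
  show ?case
  proof (cases E)
    case Nil
    thus ?thesis using "1.prems"(2) by (auto simp: unifiable_eqns_def dest: spec[of _ Var])
  next
    case (Cons e E')
    obtain l r where e: "e = (l, r)" by (cases e)
    have wf: "wf_trm ar l" "wf_trm ar r" "wf_eqns ar E'"
      using "1.prems"(1) by (auto simp: Cons e wf_eqns_def)
    have not_unif: "\<not> unifiable_eqns ar ((l, r) # E')" using "1.prems"(2) by (simp add: Cons e)
    hence not_unif': "\<not> unifiable_eqns ar ((r, l) # E')"
      by (simp add: unifiable_eqns_def) metis
    \<comment> \<open>Both orientations are treated at once: a swap is no induction step, since it
      may enlarge the left-hand sides.\<close>
    have var: "refutable ar ((Var x, t) # E')"
      if xt: "(l, r) = (Var x, t) \<or> (l, r) = (t, Var x)" for x t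
    proof -
      have nu: "\<not> unifiable_eqns ar ((Var x, t) # E')" and "wf_trm ar t"
        using xt not_unif not_unif' wf by auto
      have vE: "vars_eqns E = insert x (vars_trm t \<union> vars_eqns E')"
        using xt by (auto simp: Cons e vars_eqns_def)
      consider "t = Var x" | "x \<in> vars_trm t" "t \<noteq> Var x" | "x \<notin> vars_trm t" by blast
      thus ?thesis
      proof cases
        case 1
        have "\<not> unifiable_eqns ar E'" using nu by (auto simp: 1 unifiable_eqns_def)
        hence "refutable ar E'" using wf(3) vE by (intro IH) (auto simp: Cons e)
        thus ?thesis by (rule refutable_mono) (auto simp: solves_def)
      next
        case 2
        thus ?thesis by (rule refutable_occurs)
      next
        case 3
        let ?E = "subst_eqns (Var(x := t)) E'"
        \<comment> \<open>As \<open>x\<close> is not in \<open>t\<close>, it disappears from the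
          system and the inclusion becomes strict.\<close>
        have "vars_eqns ?E \<subseteq> (vars_eqns E' - {x}) \<union> vars_trm t"
          by (fastforce simp: vars_eqns_def vars_trm_subst split: if_splits)
        hence "vars_eqns ?E \<subset> vars_eqns E" using 3 vE by auto
        moreover have "wf_eqns ar ?E"
          using wf(3) \<open>wf_trm ar t\<close> by (auto simp: wf_eqns_def intro!: wf_trm_subst)
        moreover have "\<not> unifiable_eqns ar ?E"
          using unifiable_eliminate[of ar x t E'] 3 \<open>wf_trm ar t\<close> nu by blast
        ultimately show ?thesis by (intro refutable_eliminate IH) auto
      qed
    qed
    show ?thesis
    proof (cases l)
      case (Var x)
      thus ?thesis using var[of x r] by (simp add: Cons e)
    next
      case l: (Fn f ss)
      show ?thesis
      proof (cases r)
        case (Var x)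
        thus ?thesis using var[of x l] by (auto simp: Cons e intro: refutable_swap)
      next
        case r: (Fn g ts)
        show ?thesis
        proof (cases "f = g")
          case False
          thus ?thesis by (simp add: Cons e l r refutable_clash)
        next
          case True
          let ?E = "zip ss ts @ E'"
          \<comment> \<open>Both lists have the arity of the common head, so \<open>zip\<close>
            drops no argument.\<close>
          have len: "length ss = length ts" using wf by (simp add: l r True)
          have "vars_eqns ?E \<subseteq> vars_eqns E"
            by (auto simp: Cons e l r vars_eqns_def dest: set_zip_leftD set_zip_rightD)
          moreover have "(\<Sum>(u, v) \<leftarrow> zip ss ts. Suc (size u)) = size_list size ss"
            using len by (induction ss ts rule: list_induct2) auto
          hence "(\<Sum>(u, v) \<leftarrow> ?E. Suc (size u)) < (\<Sum>(u, v) \<leftarrow> E. Suc (size u))"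
            by (simp add: Cons e l)
          moreover have "wf_eqns ar ?E"
            using wf by (auto simp: l r wf_eqns_def dest: set_zip_leftD set_zip_rightD)
          moreover have "\<not> unifiable_eqns ar ?E"
          proof
            assume "unifiable_eqns ar ?E"
            then obtain \<sigma> where \<sigma>: "\<And>x. wf_trm ar (\<sigma> x)"
              "\<And>u v. (u, v) \<in> set ?E \<Longrightarrow> subst \<sigma> u = subst \<sigma> v"
              unfolding unifiable_eqns_def by blast
            have "map (subst \<sigma>) ss = map (subst \<sigma>) ts"
              using len \<sigma>(2) by (intro nth_equalityI) (auto simp: set_zip)
            with \<sigma> have "unifiable_eqns ar ((l, r) # E')"
              unfolding unifiable_eqns_def by (intro exI[of _ \<sigma>]) (auto simp: l r True)
            thus False using not_unif by blast
          qed
          ultimately show ?thesis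
            unfolding Cons e l r True by (intro refutable_decompose IH) (auto simp: Cons e l r True)
        qed
      qed
    qed
  qed
qed

theorem theorem3p4:
  fixes ar :: "'f \<Rightarrow> nat" and s t :: "('f, 'v) trm"
  assumes "wf_trm ar s" and "wf_trm ar t"
    and "\<not> unifiable ar s t"
  shows "\<exists>(A :: nat set) F. finite A \<and> algebra ar A F \<and> separates A F s t"
proof -
  have "refutable ar [(s, t)]"
    using assms by (intro refutable_if_not_unifiable_eqns)
      (auto simp: wf_eqns_def unifiable_eqns_def unifiable_def)
  then obtain A :: "nat set" and F where ref: "refutes ar A F [(s, t)]"
    unfolding refutable_def by blast
  then obtain c where c: "c \<in> A" by (auto simp: refutes_def algebra_def)
  have "eval_trm F a s \<noteq> eval_trm F a t" if a: "\<forall>x \<in> vars_trm s \<union> vars_trm t. a x \<in> A" for a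
  proof -
    \<comment> \<open>Values outside \<open>A\<close> occur only at variables foreign to both terms;
      resetting them to \<open>c\<close> leaves both evaluations unchanged.\<close>
    let ?b = "\<lambda>x. if a x \<in> A then a x else c"
    have "eval_trm F ?b s = eval_trm F a s" "eval_trm F ?b t = eval_trm F a t"
      using a by (auto intro: eval_trm_cong)
    moreover have "range ?b \<subseteq> A" using c by auto
    hence "\<not> solves F ?b [(s, t)]" using ref unfolding refutes_def by blast
    ultimately show ?thesis by (simp add: solves_def)
  qed
  thus ?thesis using ref unfolding separates_def refutes_def by blast
qed

end
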